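(* For $n\ge 1$ and $w\in S_n$, let $\ell(w)=\#\{1\le i<j\le n: w(i)>w(j)\}$ be the number of inversions of $w$, let $J(w)=\{i\in[n-1] : w^{-1}(i+1)<w^{-1}(i)\}$ be the set of left descents of $w$, and let $d(w)=\#J(w)$. Call $w$ proper if $\ell(w)-\binom{d(w)+1}{2}\le n$. If $w\in S_n$ is chosen uniformly at random, then $\Pr[w \text{ is proper}]\to 0$ as $n\to\infty$.
   Context: $S_n$ is the symmetric group on $[n]=\{1,\dots,n\}$. *)

theory Defs
  imports
    "HOL-Combinatorics.Combinatorics"
    "HOL-Probability.Probability"
begin

text \<open>
  A permutation of \<open>{1..n}\<close> is a function \<open>w :: nat \<Rightarrow> nat\<close> with \<open>w permutes {1..n}\<close>.
  Such a \<open>w\<close> fixes every number outside \<open>{1..n}\<close>, so \<open>n\<close> has to be an explicit parameter,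
  and \<open>inv w\<close> is again the inverse permutation of \<open>{1..n}\<close>.
\<close>

definition sym_group :: "nat \<Rightarrow> (nat \<Rightarrow> nat) set" where
  "sym_group n = {w. w permutes {1..n}}"

definition num_inversions :: "nat \<Rightarrow> (nat \<Rightarrow> nat) \<Rightarrow> nat" where
  "num_inversions n w = card {(i, j). 1 \<le> i \<and> i < j \<and> j \<le> n \<and> w i > w j}"

definition left_descents :: "nat \<Rightarrow> (nat \<Rightarrow> nat) \<Rightarrow> nat set" where
  "left_descents n w = {i \<in> {1..n - 1}. inv w (i + 1) < inv w i}"

definition num_left_descents :: "nat \<Rightarrow> (nat \<Rightarrow> nat) \<Rightarrow> nat" where
  "num_left_descents n w = card (left_descents n w)"

text \<open>The difference is taken in the integers, so that it is not truncated at zero.\<close>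

definition proper_perm :: "nat \<Rightarrow> (nat \<Rightarrow> nat) \<Rightarrow> bool" where
  "proper_perm n w \<longleftrightarrow>
     int (num_inversions n w) - int ((num_left_descents n w + 1) choose 2) \<le> int n"

end

theory Submission
  imports Defs
begin

text \<open>
  Both \<open>\<ell>(w)\<close> and \<open>d(w)\<close> count inversions of a permutation (of \<open>w\<close>, respectively of its inverse)
  at a fixed set \<open>P\<close> of position pairs. Writing such a count as a sum of signs \<open>\<plusminus>1\<close>, the signs at
  two disjoint pairs are uncorrelated, because exchanging the two entries of one pair flips one sign
  and keeps the other. So the second moment of the sign sum is at most the number of
  intersecting pairs of elements of \<open>P\<close>: \<open>O(n^3)\<close> for \<open>\<ell>\<close> and \<open>O(n)\<close> for \<open>d\<close>. By
  Chebyshev's inequality \<open>\<ell>\<close> is close to \<open>n\<^sup>2/4\<close> and \<open>d\<close> is close to \<open>n/2\<close>, hence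
  \<open>d(d+1)/2\<close> is close to \<open>n\<^sup>2/8\<close>, with probability \<open>1 - O(1/n)\<close>.
\<close>

section \<open>Sign sums over position pairs and their second moment\<close>

definition inv_sign :: "(nat \<Rightarrow> nat) \<Rightarrow> nat \<times> nat \<Rightarrow> real" where
  "inv_sign w p = (if w (fst p) > w (snd p) then 1 else - 1)"

definition sign_sum :: "(nat \<times> nat) set \<Rightarrow> (nat \<Rightarrow> nat) \<Rightarrow> real" where
  "sign_sum P w = (\<Sum>p\<in>P. inv_sign w p)"

definition meets :: "nat \<times> nat \<Rightarrow> nat \<times> nat \<Rightarrow> bool" where
  "meets p q \<longleftrightarrow> {fst p, snd p} \<inter> {fst q, snd q} \<noteq> {}"

lemma finite_sym_group: "finite (sym_group n)"
  by (simp add: sym_group_def finite_permutations)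

lemma card_sym_group: "card (sym_group n) = fact n"
  unfolding sym_group_def by (rule card_permutations) simp_all

lemma sym_group_nonempty: "sym_group n \<noteq> {}"
  using permutes_id[of "{1..n}"] unfolding sym_group_def by blast

lemma sign_sum_eq_card:
  assumes "finite P"
  shows "sign_sum P w = 2 * real (card {p \<in> P. w (fst p) > w (snd p)}) - real (card P)"
proof -
  have "inv_sign w p = 2 * of_bool (w (fst p) > w (snd p)) - 1" for p
    by (simp add: inv_sign_def)
  then have "sign_sum P w = 2 * (\<Sum>p\<in>P. of_bool (w (fst p) > w (snd p))) - real (card P)"
    by (simp add: sign_sum_def sum_subtractf flip: sum_distrib_left)
  with assms show ?thesis
    by (simp add: Int_def)
qed

text \<open>Composing with the transposition of the two entries of \<open>p\<close> permutes the
  group, so the sum equals its own negative.\<close>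

lemma sum_inv_sign_disjoint:
  assumes p: "fst p \<in> {1..n}" "snd p \<in> {1..n}" "fst p \<noteq> snd p" and "\<not> meets p q"
  shows "(\<Sum>w\<in>sym_group n. inv_sign w p * inv_sign w q) = 0"
proof -
  let ?t = "Transposition.transpose (fst p) (snd p)"
  have "(\<Sum>w\<in>sym_group n. inv_sign w p * inv_sign w q)
      = (\<Sum>w\<in>sym_group n. inv_sign (w \<circ> ?t) p * inv_sign (w \<circ> ?t) q)"
    unfolding sym_group_def
    by (rule sum_permutations_compose_right) (use p in \<open>simp add: permutes_swap_id\<close>)
  also have "\<dots> = (\<Sum>w\<in>sym_group n. - (inv_sign w p * inv_sign w q))"
  proof (rule sum.cong)
    fix w assume "w \<in> sym_group n"
    then have "inj w"
      by (simp add: sym_group_def permutes_inj)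
    \<comment> \<open>\<open>inv_sign\<close> gives a tie the value -1 in either order, so the sign
      flip depends on distinct values.\<close>
    then have "w (fst p) \<noteq> w (snd p)"
      using p by (auto dest: injD)
    then have "inv_sign (w \<circ> ?t) p = - inv_sign w p"
      by (auto simp: inv_sign_def)
    moreover have "inv_sign (w \<circ> ?t) q = inv_sign w q"
      using \<open>\<not> meets p q\<close> by (auto simp: inv_sign_def meets_def Transposition.transpose_def)
    ultimately show "inv_sign (w \<circ> ?t) p * inv_sign (w \<circ> ?t) q = - (inv_sign w p * inv_sign w q)"
      by simp
  qed simp
  finally show ?thesis
    by (simp add: sum_negf)
qed

text \<open>Expanding the square gives one correlation sum per ordered pair \<open>(p, q)\<close>.
  Those with disjoint \<open>p\<close>, \<open>q\<close> vanish; each of the others, including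
  \<open>q = p\<close>, is at most n!, and each \<open>p\<close> has at most \<open>K\<close> of
  them.\<close>

lemma sum_sign_sum_square_le:
  assumes fin: "finite P"
    and P: "\<And>p. p \<in> P \<Longrightarrow> fst p \<in> {1..n} \<and> snd p \<in> {1..n} \<and> fst p \<noteq> snd p"
    and K: "\<And>p. p \<in> P \<Longrightarrow> card {q \<in> P. meets p q} \<le> K"
  shows "(\<Sum>w\<in>sym_group n. (sign_sum P w)\<^sup>2) \<le> fact n * real (card P * K)"
proof -
  let ?c = "\<lambda>p q. \<Sum>w\<in>sym_group n. inv_sign w p * inv_sign w q"
  have c_le: "?c p q \<le> fact n" for p q
  proof -
    have "?c p q \<le> (\<Sum>w\<in>sym_group n. 1)"
      by (rule sum_mono) (simp add: inv_sign_def)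
    then show ?thesis
      by (simp add: card_sym_group)
  qed
  have "(\<Sum>w\<in>sym_group n. (sign_sum P w)\<^sup>2)
      = (\<Sum>w\<in>sym_group n. \<Sum>p\<in>P. \<Sum>q\<in>P. inv_sign w p * inv_sign w q)"
    by (simp add: sign_sum_def power2_eq_square sum_product)
  also have "\<dots> = (\<Sum>p\<in>P. \<Sum>w\<in>sym_group n. \<Sum>q\<in>P. inv_sign w p * inv_sign w q)"
    by (rule sum.swap)
  also have "\<dots> = (\<Sum>p\<in>P. \<Sum>q\<in>P. ?c p q)"
    by (intro sum.cong refl sum.swap)
  also have "\<dots> \<le> (\<Sum>p\<in>P. fact n * real K)"
  proof (rule sum_mono)
    fix p assume "p \<in> P"
    have "(\<Sum>q\<in>P. ?c p q) = (\<Sum>q\<in>{q \<in> P. meets p q}. ?c p q)"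
      using fin P[OF \<open>p \<in> P\<close>] by (intro sum.mono_neutral_right) (auto intro: sum_inv_sign_disjoint)
    also have "\<dots> \<le> (\<Sum>q\<in>{q \<in> P. meets p q}. fact n)"
      by (intro sum_mono c_le)
    also have "\<dots> \<le> fact n * real K"
      using K[OF \<open>p \<in> P\<close>] by simp
    finally show "(\<Sum>q\<in>P. ?c p q) \<le> fact n * real K" .
  qed
  also have "\<dots> = fact n * real (card P * K)"
    by simp
  finally show ?thesis .
qed

text \<open>Chebyshev's inequality in counting form, with no division by
  \<open>a\<^sup>2\<close>.\<close>

lemma card_abs_ge_le:
  fixes f :: "'a \<Rightarrow> real"
  assumes "finite S" "a \<ge> 0"
  shows "real (card {x \<in> S. a \<le> \<bar>f x\<bar>}) * a\<^sup>2 \<le> (\<Sum>x\<in>S. (f x)\<^sup>2)"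
proof -
  have "real (card {x \<in> S. a \<le> \<bar>f x\<bar>}) * a\<^sup>2 = (\<Sum>x\<in>{x \<in> S. a \<le> \<bar>f x\<bar>}. a\<^sup>2)"
    by simp
  also have "\<dots> \<le> (\<Sum>x\<in>{x \<in> S. a \<le> \<bar>f x\<bar>}. (f x)\<^sup>2)"
    by (rule sum_mono) (use \<open>a \<ge> 0\<close> in \<open>auto simp: abs_le_square_iff[symmetric]\<close>)
  also have "\<dots> \<le> (\<Sum>x\<in>S. (f x)\<^sup>2)"
    by (rule sum_mono2) (use assms in auto)
  finally show ?thesis .
qed

section \<open>Position pairs behind inversions and left descents\<close>

definition all_pairs :: "nat \<Rightarrow> (nat \<times> nat) set" where
  "all_pairs n = {(i, j). 1 \<le> i \<and> i < j \<and> j \<le> n}"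

definition adjacent_pairs :: "nat \<Rightarrow> (nat \<times> nat) set" where
  "adjacent_pairs n = (\<lambda>i. (i, i + 1)) ` {1..n - 1}"

lemma all_pairs_subset: "all_pairs n \<subseteq> {1..n} \<times> {1..n}"
  by (auto simp: all_pairs_def)

lemma finite_all_pairs: "finite (all_pairs n)"
  by (rule finite_subset[OF all_pairs_subset]) simp

lemma card_all_pairs: "2 * real (card (all_pairs n)) = real n * (real n - 1)"
proof (induction n)
  case 0
  have "all_pairs 0 = {}"
    by (auto simp: all_pairs_def)
  then show ?case
    by simp
next
  case (Suc n)
  have "all_pairs (Suc n) = all_pairs n \<union> (\<lambda>i. (i, Suc n)) ` {1..n}"
    by (auto simp: all_pairs_def)
  moreover have "all_pairs n \<inter> (\<lambda>i. (i, Suc n)) ` {1..n} = {}"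
    by (auto simp: all_pairs_def)
  moreover have "card ((\<lambda>i. (i, Suc n)) ` {1..n}) = n"
    by (simp add: card_image inj_on_def)
  ultimately have "card (all_pairs (Suc n)) = card (all_pairs n) + n"
    by (simp add: card_Un_disjoint finite_all_pairs)
  with Suc show ?case
    by (simp add: algebra_simps)
qed

lemma card_adjacent_pairs: "card (adjacent_pairs n) = n - 1"
  by (simp add: adjacent_pairs_def card_image inj_on_def)

text \<open>This makes the sign sum twice the deviation of the inversion number from
  n(n-1)/4.\<close>

lemma sign_sum_all_pairs:
  "sign_sum (all_pairs n) w = 2 * real (num_inversions n w) - real n * (real n - 1) / 2"
proof -
  have "{p \<in> all_pairs n. w (fst p) > w (snd p)} = {(i, j). 1 \<le> i \<and> i < j \<and> j \<le> n \<and> w i > w j}"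
    by (auto simp: all_pairs_def)
  then show ?thesis
    using card_all_pairs[of n] by (simp add: sign_sum_eq_card finite_all_pairs num_inversions_def)
qed

lemma sign_sum_adjacent_pairs_inv:
  "sign_sum (adjacent_pairs n) (inv w) = 2 * real (num_left_descents n w) - real (n - 1)"
proof -
  have "{p \<in> adjacent_pairs n. inv w (fst p) > inv w (snd p)} = (\<lambda>i. (i, i + 1)) ` left_descents n w"
    by (auto simp: adjacent_pairs_def left_descents_def)
  moreover have "card ((\<lambda>i. (i, i + 1)) ` left_descents n w) = num_left_descents n w"
    by (simp add: card_image inj_on_def num_left_descents_def)
  moreover have "finite (adjacent_pairs n)"
    by (simp add: adjacent_pairs_def)
  ultimately show ?thesis
    by (simp add: sign_sum_eq_card card_adjacent_pairs)
qed

section \<open>Second moments of the two statistics\<close>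

lemma sum_sign_sum_all_pairs_square_le:
  "(\<Sum>w\<in>sym_group n. (sign_sum (all_pairs n) w)\<^sup>2) \<le> fact n * (4 * real n ^ 3)"
proof -
  have "card {q \<in> all_pairs n. meets p q} \<le> 4 * n" for p
  proof -
    let ?e = "{fst p, snd p}"
    have e: "card ?e \<le> 2"
      by (simp add: card_insert_if)
    \<comment> \<open>A pair meeting \<open>p\<close> has its first or its second entry in
      \<open>?e\<close>, and at most n choices for the other one.\<close>
    have "card {q \<in> all_pairs n. meets p q} \<le> card (?e \<times> {1..n} \<union> {1..n} \<times> ?e)"
      by (rule card_mono) (auto simp: meets_def all_pairs_def)
    also have "\<dots> \<le> card (?e \<times> {1..n}) + card ({1..n} \<times> ?e)"
      by (rule card_Un_le)
    also have "\<dots> = 2 * n * card ?e"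
      unfolding card_cartesian_product by simp
    also have "\<dots> \<le> 2 * n * 2"
      using e by (rule mult_le_mono2)
    finally show ?thesis
      by simp
  qed
  then have "(\<Sum>w\<in>sym_group n. (sign_sum (all_pairs n) w)\<^sup>2)
      \<le> fact n * real (card (all_pairs n) * (4 * n))"
    by (intro sum_sign_sum_square_le finite_all_pairs) (auto simp: all_pairs_def)
  also have "\<dots> \<le> fact n * (real (n * n) * (4 * real n))"
  proof -
    have "card (all_pairs n) \<le> n * n"
      using card_mono[OF _ all_pairs_subset, of n] by (simp add: card_cartesian_product)
    then have "real (card (all_pairs n)) \<le> real (n * n)"
      by (rule of_nat_mono)
    then have "real (card (all_pairs n)) * (4 * real n) \<le> real (n * n) * (4 * real n)"
      by (rule mult_right_mono) simp
    then show ?thesis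
      by simp
  qed
  finally show ?thesis
    by (simp add: power3_eq_cube mult_ac)
qed

lemma sum_sign_sum_adjacent_pairs_square_le:
  "(\<Sum>w\<in>sym_group n. (sign_sum (adjacent_pairs n) (inv w))\<^sup>2) \<le> fact n * (3 * real n)"
proof -
  have "card {q \<in> adjacent_pairs n. meets p q} \<le> 3" if p: "p \<in> adjacent_pairs n" for p
  proof -
    obtain i where i: "p = (i, i + 1)"
      using p by (auto simp: adjacent_pairs_def)
    \<comment> \<open>Only the pair itself and its two neighbours can meet it. For
      \<open>i = 1\<close> the entry \<open>(0, 1)\<close> is not an adjacent pair, which is
      harmless for an upper bound.\<close>
    have "{q \<in> adjacent_pairs n. meets p q} \<subseteq> set [(i - 1, i), (i, i + 1), (i + 1, i + 2)]"
      by (auto simp: adjacent_pairs_def meets_def i)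
    from card_mono[OF _ this] show ?thesis
      using card_length[of "[(i - 1, i), (i, i + 1), (i + 1, i + 2)]"] by simp
  qed
  then have "(\<Sum>w\<in>sym_group n. (sign_sum (adjacent_pairs n) w)\<^sup>2)
      \<le> fact n * real (card (adjacent_pairs n) * 3)"
    by (intro sum_sign_sum_square_le) (auto simp: adjacent_pairs_def)
  also have "\<dots> \<le> fact n * (3 * real n)"
    by (simp add: card_adjacent_pairs)
  \<comment> \<open>Inversion is a bijection of the group, so \<open>w\<close> and
    \<open>inv w\<close> have the same distribution.\<close>
  also have "(\<Sum>w\<in>sym_group n. (sign_sum (adjacent_pairs n) w)\<^sup>2)
      = (\<Sum>w\<in>sym_group n. (sign_sum (adjacent_pairs n) (inv w))\<^sup>2)"
    unfolding sym_group_def by (rule sum_permutations_inverse)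
  finally show ?thesis .
qed

section \<open>Properness forces a large deviation\<close>

lemma proper_perm_imp_deviation:
  assumes "proper_perm n w" "n \<ge> 32"
  shows "real n ^ 2 / 10 \<le> \<bar>sign_sum (all_pairs n) w\<bar>
       \<or> real n / 10 \<le> \<bar>sign_sum (adjacent_pairs n) (inv w)\<bar>"
proof (rule ccontr)
  assume neg: "\<not> ?thesis"
  define d l x where "d = real (num_left_descents n w)" and "l = real (num_inversions n w)"
    and "x = real n"
  have x: "x \<ge> 32"
    using assms(2) by (simp add: x_def)
  have "2 * d - (x - 1) < x / 10"
    using neg assms(2) unfolding sign_sum_adjacent_pairs_inv d_def x_def by linarith
  then have d: "0 \<le> d" "d \<le> 11 / 20 * x"
    by (simp_all add: d_def)
  have l: "x * (x - 1) / 2 - 2 * l < x\<^sup>2 / 10"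
    using neg unfolding sign_sum_all_pairs l_def x_def by linarith
  have "real_of_int (int (num_inversions n w) - int ((num_left_descents n w + 1) choose 2)) \<le> real_of_int (int n)"
    using assms(1) unfolding proper_perm_def of_int_le_iff .
  moreover have "real ((num_left_descents n w + 1) choose 2) = d * (d + 1) / 2"
    by (simp add: choose_two d_def real_of_nat_div algebra_simps)
  ultimately have "l \<le> x + d * (d + 1) / 2"
    by (simp add: l_def x_def)
  also have "d * (d + 1) \<le> 11 / 20 * x * (11 / 20 * x + 1)"
    using d x by (intro mult_mono) auto
  finally have "l \<le> x + 11 / 20 * x * (11 / 20 * x + 1) / 2"
    by simp
  moreover have "x * x \<ge> 32 * x"
    using x by (intro mult_right_mono) auto
  \<comment> \<open>With small deviations, \<open>l\<close> exceeds x^2/5 - x/4, while properness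
    bounds it by 0.15125 x^2 + 1.275 x. These conflict once 0.04875 x \<ge> 1.525, and 32 is the
    least such integer.\<close>
  ultimately show False
    using l x unfolding power2_eq_square by argo
qed

text \<open>Chebyshev's inequality bounds the two deviation events by 4n^3 / (n^2/10)^2 = 400/n and
  3n / (n/10)^2 = 300/n; the union bound adds them.\<close>

lemma prob_proper_perm_le:
  assumes "n \<ge> 32"
  shows "measure_pmf.prob (pmf_of_set (sym_group n)) {w. proper_perm n w} \<le> 700 / real n"
proof -
  let ?A = "{w \<in> sym_group n. real n ^ 2 / 10 \<le> \<bar>sign_sum (all_pairs n) w\<bar>}"
  let ?B = "{w \<in> sym_group n. real n / 10 \<le> \<bar>sign_sum (adjacent_pairs n) (inv w)\<bar>}"
  have n: "real n > 0"
    using assms by simp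
  have "real (card ?A) * (real n ^ 2 / 10)\<^sup>2 \<le> fact n * (4 * real n ^ 3)"
    using card_abs_ge_le[OF finite_sym_group] sum_sign_sum_all_pairs_square_le
    by (rule order_trans) simp
  then have "real n ^ 3 * (real (card ?A) * real n) \<le> real n ^ 3 * (fact n * 400)"
    by (simp add: field_simps eval_nat_numeral)
  then have A: "real (card ?A) * real n \<le> fact n * 400"
    using n by (simp only: mult_le_cancel_left_pos zero_less_power)
  have "real (card ?B) * (real n / 10)\<^sup>2 \<le> fact n * (3 * real n)"
    using card_abs_ge_le[OF finite_sym_group] sum_sign_sum_adjacent_pairs_square_le
    by (rule order_trans) simp
  then have "real n * (real (card ?B) * real n) \<le> real n * (fact n * 300)"
    by (simp add: field_simps eval_nat_numeral)
  then have B: "real (card ?B) * real n \<le> fact n * 300"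
    using n by (simp only: mult_le_cancel_left_pos)
  have "card (sym_group n \<inter> {w. proper_perm n w}) \<le> card (?A \<union> ?B)"
    using proper_perm_imp_deviation[OF _ assms] finite_sym_group by (intro card_mono) auto
  also have "\<dots> \<le> card ?A + card ?B"
    by (rule card_Un_le)
  finally have "real (card (sym_group n \<inter> {w. proper_perm n w})) * real n
      \<le> real (card ?A + card ?B) * real n"
    by (intro mult_right_mono of_nat_mono) auto
  also have "\<dots> \<le> fact n * 700"
    using A B by (simp add: algebra_simps)
  finally show ?thesis
    using n by (simp add: measure_pmf_of_set finite_sym_group sym_group_nonempty card_sym_group field_simps)
qed

theorem theorem1p2:
  shows "(\<lambda>n. measure_pmf.prob (pmf_of_set (sym_group n)) {w. proper_perm n w}) \<longlonglongrightarrow> 0"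
proof (rule tendsto_sandwich[where f = "\<lambda>_. 0" and h = "\<lambda>n. 700 / real n"])
  show "\<forall>\<^sub>F n in sequentially. measure_pmf.prob (pmf_of_set (sym_group n)) {w. proper_perm n w} \<le> 700 / real n"
    using eventually_ge_at_top[of 32] by eventually_elim (rule prob_proper_perm_le)
  show "(\<lambda>n. 700 / real n) \<longlonglongrightarrow> 0"
    by (rule lim_const_over_n)
qed simp_all

end
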